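(* Let $\mathfrak{A}_4=\mathbb{C}\langle u_1,u_2,u_3,u_4\rangle$ with indices of generators read modulo $4$, and for $\hbar\in\mathbb{R}$, $q=e^{\mathrm{i}\hbar}$, let $\partial_{t_2}$ be the derivation of $\mathfrak{A}_4$ given by $$\partial_{t_2}(u_n)=q^2\left(u_{n+2}u_{n+1}u_n+u_{n+1}^2u_n+u_{n+1}u_n^2-u_n^2u_{n+3}-u_nu_{n+3}u_{n+2}-u_nu_{n+3}^2\right),\quad n\in\mathbb{Z}_4.$$ Let $\mathfrak{I}\subset\mathfrak{A}_4$ be the two-sided ideal generated by $u_iu_j-\omega_{i,j}u_ju_i$, $1\le i<j\le4$, with constants $\omega_{i,j}\in\mathbb{C}^*$. Then $\mathfrak{I}$ is stable under $\partial_{t_2}$ and under the Hermitian conjugation $\dagger$ if and only if there is $\omega=q^2=e^{2\mathrm{i}\hbar}$ with $\hbar\in\mathbb{R}$ such that $(\omega_{1,2},\omega_{1,3},\omega_{2,3},\omega_{1,4},\omega_{2,4},\omega_{3,4})$ is one of the following: (a) $(\omega,\ 1,\ \omega,\ \omega^{-1},\ 1,\ \omega)$; (b) $(\omega,\ -1,\ -\omega,\ -\omega^{-1},\ -1,\ \omega)$; (c) $(-\omega,\ -1,\ \omega,\ -\omega^{-1},\ 1,\ \omega)$; (d) $(-\omega,\ 1,\ -\omega,\ \omega^{-1},\ -1,\ \omega)$. Moreover, in each of these four cases (with $q=e^{\mathrm{i}\hbar}$, $q^2=\omega$, in $\partial_{t_2}$) the system induced by $\partial_{t_2}$ on $\mathfrak{A}_4/\mathfrak{I}$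 is a super-integrable quantum system.
   Context: The Hermitian conjugation $\dagger$ on $\mathfrak{A}_4$ is the conjugate-linear anti-automorphism with $u_n^\dagger=u_n$, $\alpha^\dagger=\bar\alpha$ for $\alpha\in\mathbb{C}$, $(ab)^\dagger=b^\dagger a^\dagger$. Stability under $\partial_{t_2}$ means $\partial_{t_2}(\mathfrak{I})\subset\mathfrak{I}$ (this does not depend on the nonzero scalar $q^2$); stability under $\dagger$ means $\mathfrak{I}^\dagger=\mathfrak{I}$. The quotient automatically has the basis of normally ordered monomials $u_4^{k_4}u_3^{k_3}u_2^{k_2}u_1^{k_1}$. A first integral is an element $h\in\mathfrak{A}_4/\mathfrak{I}$ with $\partial_{t_2}(h)=0$. The system of four equations is called super-integrable if it admits three algebraically independent first integrals which commute with each other. *)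

theory Defs
  imports Complex_Main "HOL-Library.Poly_Mapping" "HOL-Library.Numeral_Type"
    "HOL-Algebra.QuotRing"
begin

section \<open>The free associative algebra on four generators\<close>

text \<open>
  The free monoid, written additively because the product of \<^typ>\<open>'a \<Rightarrow>\<^sub>0 'b\<close> is the convolution
  product of a monoid ring over an additively written, not necessarily commutative, monoid.
\<close>

datatype 'a fmon = Word (letters: "'a list")

instantiation fmon :: (type) monoid_add
begin

definition zero_fmon :: "'a fmon" where
  "zero_fmon = Word []"

definition plus_fmon :: "'a fmon \<Rightarrow> 'a fmon \<Rightarrow> 'a fmon" where
  "plus_fmon v w = Word (letters v @ letters w)"

instance
  by standard (simp_all add: zero_fmon_def plus_fmon_def)

end

text \<open>
  The index type \<^typ>\<open>4\<close> is the ring of integers modulo 4; the generator with index 4 is the one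
  with index 0.
\<close>

type_synonym free4 = "4 fmon \<Rightarrow>\<^sub>0 complex"

definition scalar :: "complex \<Rightarrow> free4" where
  "scalar c = Poly_Mapping.single 0 c"

definition gen :: "4 \<Rightarrow> free4" where
  "gen n = Poly_Mapping.single (Word [n]) 1"

definition free_ring :: "free4 ring" where
  "free_ring = \<lparr>carrier = UNIV, mult = (*), one = 1, zero = 0, add = (+)\<rparr>"

lemma ring_free_ring: "ring free_ring"
proof (rule ringI)
  show "abelian_group free_ring"
  proof (rule abelian_groupI)
    show "\<exists>y\<in>carrier free_ring. y \<oplus>\<^bsub>free_ring\<^esub> x = \<zero>\<^bsub>free_ring\<^esub>" for x
      by (auto simp: free_ring_def intro: exI[of _ "- x"])
  qed (simp_all add: free_ring_def algebra_simps)
  show "Group.monoid free_ring"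
    by (rule monoidI) (simp_all add: free_ring_def algebra_simps)
qed (simp_all add: free_ring_def algebra_simps)


section \<open>Derivations\<close>

fun der_word :: "(4 \<Rightarrow> free4) \<Rightarrow> 4 list \<Rightarrow> free4" where
  "der_word d [] = 0"
| "der_word d (x # xs) =
     d x * Poly_Mapping.single (Word xs) 1 + gen x * der_word d xs"

text \<open>The complex-linear derivation with prescribed values \<open>d\<close> on the generators.\<close>

definition derivation :: "(4 \<Rightarrow> free4) \<Rightarrow> free4 \<Rightarrow> free4" where
  "derivation d p =
     (\<Sum>w\<in>Poly_Mapping.keys p. scalar (Poly_Mapping.lookup p w) * der_word d (letters w))"

lemma scalar_simps:
  "scalar 0 = 0" "scalar 1 = 1" "scalar (a + b) = scalar a + scalar b"
  "scalar (a * b) = scalar a * scalar b"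
  by (simp_all add: scalar_def single_add mult_single)

lemma scalar_mult_single: "scalar c * Poly_Mapping.single w a = Poly_Mapping.single w (c * a)"
  by (simp add: scalar_def mult_single)

lemma single_mult_scalar: "Poly_Mapping.single w a * scalar c = Poly_Mapping.single w (a * c)"
  by (simp add: scalar_def mult_single)

lemma scalar_single_one: "Poly_Mapping.single w c = scalar c * Poly_Mapping.single w 1"
  by (simp add: scalar_mult_single)

lemma free4_expand:
  "(p::free4) = (\<Sum>w\<in>Poly_Mapping.keys p. Poly_Mapping.single w (Poly_Mapping.lookup p w))"
  by (rule poly_mapping_eqI)
     (auto simp: lookup_sum lookup_single when_def in_keys_iff)

lemma free4_induct [case_names zero single add]:
  assumes "P 0" "\<And>w c. P (Poly_Mapping.single w c)" "\<And>p q. P p \<Longrightarrow> P q \<Longrightarrow> P (p + q)"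
  shows "P (p::free4)"
proof -
  have "P (\<Sum>w\<in>A. Poly_Mapping.single w (Poly_Mapping.lookup p w))" if "finite A" for A
    using that by induction (auto intro: assms)
  then show ?thesis
    using free4_expand[of p] finite_keys[of p] by metis
qed

lemma scalar_commute: "scalar c * p = p * scalar c"
  by (induction p rule: free4_induct)
     (simp_all add: scalar_mult_single single_mult_scalar algebra_simps)

lemma derivation_superset:
  assumes "finite A" "Poly_Mapping.keys p \<subseteq> A"
  shows "derivation d p = (\<Sum>w\<in>A. scalar (Poly_Mapping.lookup p w) * der_word d (letters w))"
  unfolding derivation_def using assms
  by (intro sum.mono_neutral_left) (auto simp: in_keys_iff scalar_simps)

lemma derivation_add: "derivation d (p + q) = derivation d p + derivation d q"
proof -
  let ?A = "Poly_Mapping.keys p \<union> Poly_Mapping.keys q"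
  have "Poly_Mapping.keys (p + q) \<subseteq> ?A" by (rule Poly_Mapping.keys_add)
  then show ?thesis
    using derivation_superset[of ?A "p + q" d] derivation_superset[of ?A p d]
      derivation_superset[of ?A q d]
    by (simp add: lookup_add scalar_simps distrib_right sum.distrib)
qed

lemma derivation_single:
  "derivation d (Poly_Mapping.single w c) = scalar c * der_word d (letters w)"
  using derivation_superset[of "{w}" "Poly_Mapping.single w c" d] by simp

lemma derivation_zero: "derivation d 0 = 0"
  by (simp add: derivation_def)

lemma derivation_scalar: "derivation d (scalar c) = 0"
  by (simp add: scalar_def derivation_single zero_fmon_def)

lemma derivation_gen: "derivation d (gen n) = d n"
  by (simp add: gen_def derivation_single scalar_simps flip: zero_fmon_def)

lemma der_word_append:
  "der_word d (xs @ ys) =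
     der_word d xs * Poly_Mapping.single (Word ys) 1 +
     Poly_Mapping.single (Word xs) 1 * der_word d ys"
proof (induction xs)
  case Nil
  then show ?case by (simp flip: zero_fmon_def)
next
  case (Cons x xs)
  have 1: "Poly_Mapping.single (Word (xs @ ys)) (1::complex) =
      Poly_Mapping.single (Word xs) 1 * Poly_Mapping.single (Word ys) 1"
    by (simp add: mult_single plus_fmon_def)
  have 2: "Poly_Mapping.single (Word (x # xs)) (1::complex) =
      gen x * Poly_Mapping.single (Word xs) 1"
    by (simp add: gen_def mult_single plus_fmon_def)
  show ?case by (simp add: Cons 1 2 algebra_simps)
qed

lemma derivation_mult: "derivation d (p * q) = derivation d p * q + p * derivation d q"
proof (induction p rule: free4_induct)
  case (single v a)
  show ?case
  proof (induction q rule: free4_induct)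
    case (single w b)
    obtain xs ys where v: "v = Word xs" and w: "w = Word ys"
      by (metis fmon.exhaust)
    have 1: "der_word d xs * (scalar b * r) = scalar b * (der_word d xs * r)"
      "Poly_Mapping.single (Word xs) 1 * (scalar b * r) =
         scalar b * (Poly_Mapping.single (Word xs) 1 * r)" for r
      by (metis scalar_commute mult.assoc)+
    have "derivation d (Poly_Mapping.single v a * Poly_Mapping.single w b) =
      scalar a * (scalar b * (der_word d xs * Poly_Mapping.single w 1 +
        Poly_Mapping.single v 1 * der_word d ys))"
      by (simp add: v w mult_single plus_fmon_def derivation_single der_word_append
          scalar_simps mult.assoc)
    also have "\<dots> = (scalar a * der_word d xs) * (scalar b * Poly_Mapping.single w 1) +
      (scalar a * Poly_Mapping.single v 1) * (scalar b * der_word d ys)"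
      by (simp only: v w distrib_left mult.assoc 1)
    also have "\<dots> = derivation d (Poly_Mapping.single v a) * Poly_Mapping.single w b +
      Poly_Mapping.single v a * derivation d (Poly_Mapping.single w b)"
      by (simp add: v w derivation_single scalar_mult_single)
    finally show ?case .
  qed (simp_all add: derivation_zero derivation_add algebra_simps)
qed (simp_all add: derivation_zero derivation_add algebra_simps)

text \<open>\<open>volterra2 h\<close> is the derivation \<open>\<partial>\<^sub>t\<^sub>2\<close> for the parameter \<open>q = exp (\<i> * h)\<close>.\<close>

definition volterra2 :: "real \<Rightarrow> free4 \<Rightarrow> free4" where
  "volterra2 h = derivation (\<lambda>n.
     scalar (exp (\<i> * complex_of_real h) ^ 2) *
       (gen (n + 2) * gen (n + 1) * gen n + gen (n + 1) ^ 2 * gen n + gen (n + 1) * gen n ^ 2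
        - gen n ^ 2 * gen (n + 3) - gen n * gen (n + 3) * gen (n + 2) - gen n * gen (n + 3) ^ 2))"


section \<open>Hermitian conjugation\<close>

definition dagger :: "free4 \<Rightarrow> free4" where
  "dagger p = (\<Sum>w\<in>Poly_Mapping.keys p.
     Poly_Mapping.single (Word (rev (letters w))) (cnj (Poly_Mapping.lookup p w)))"

lemma dagger_superset:
  assumes "finite A" "Poly_Mapping.keys p \<subseteq> A"
  shows "dagger p = (\<Sum>w\<in>A.
     Poly_Mapping.single (Word (rev (letters w))) (cnj (Poly_Mapping.lookup p w)))"
  unfolding dagger_def using assms
  by (intro sum.mono_neutral_left) (auto simp: in_keys_iff)

lemma dagger_add: "dagger (p + q) = dagger p + dagger q"
proof -
  let ?A = "Poly_Mapping.keys p \<union> Poly_Mapping.keys q"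
  have "Poly_Mapping.keys (p + q) \<subseteq> ?A" by (rule Poly_Mapping.keys_add)
  then show ?thesis
    using dagger_superset[of ?A "p + q"] dagger_superset[of ?A p] dagger_superset[of ?A q]
    by (simp add: lookup_add single_add sum.distrib)
qed

lemma dagger_single:
  "dagger (Poly_Mapping.single w c) = Poly_Mapping.single (Word (rev (letters w))) (cnj c)"
  using dagger_superset[of "{w}" "Poly_Mapping.single w c"] by simp

lemma dagger_zero: "dagger 0 = 0"
  by (simp add: dagger_def)

lemma dagger_scalar: "dagger (scalar c) = scalar (cnj c)"
  by (simp add: scalar_def dagger_single zero_fmon_def)

lemma dagger_gen: "dagger (gen n) = gen n"
  by (simp add: gen_def dagger_single)

lemma dagger_mult: "dagger (p * q) = dagger q * dagger p"
proof (induction p rule: free4_induct)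
  case (single v a)
  show ?case
    by (induction q rule: free4_induct)
       (simp_all add: dagger_zero dagger_add dagger_single mult_single plus_fmon_def
          algebra_simps)
qed (simp_all add: dagger_zero dagger_add algebra_simps)


section \<open>The ideal and the induced system on the quotient\<close>

definition quad_ideal :: "(nat \<Rightarrow> nat \<Rightarrow> complex) \<Rightarrow> free4 set" where
  "quad_ideal w = genideal free_ring
     {gen (of_nat i) * gen (of_nat j) - scalar (w i j) * gen (of_nat j) * gen (of_nat i) | i j.
        1 \<le> i \<and> i < j \<and> j \<le> 4}"

lemma ideal_quad_ideal: "ideal (quad_ideal w) free_ring"
  unfolding quad_ideal_def
  by (rule ring.genideal_ideal[OF ring_free_ring]) (simp add: free_ring_def)

abbreviation quotient_ring :: "free4 set \<Rightarrow> free4 set ring" where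
  "quotient_ring I \<equiv> free_ring Quot I"

definition coset :: "free4 set \<Rightarrow> free4 \<Rightarrow> free4 set" where
  "coset I p = I +>\<^bsub>free_ring\<^esub> p"

text \<open>
  The map on cosets induced by \<open>D\<close>. If \<open>D\<close> is additive and maps \<open>I\<close> into \<open>I\<close>, all members of the
  union are the same coset.
\<close>

definition induced :: "free4 set \<Rightarrow> (free4 \<Rightarrow> free4) \<Rightarrow> free4 set \<Rightarrow> free4 set" where
  "induced I D X = (\<Union>p\<in>X. coset I (D p))"

lemma induced_coset:
  assumes I: "ideal I free_ring" and DI: "D ` I \<subseteq> I" and add: "\<And>p q. D (p + q) = D p + D q"
  shows "induced I D (coset I p) = coset I (D p)"
proof -
  interpret ideal I free_ring by (rule I)
  have c: "coset I r = {i + r | i. i \<in> I}" for r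
    by (auto simp: coset_def a_r_coset_def' free_ring_def)
  have I0: "0 \<in> I" and Ia: "\<And>a b. a \<in> I \<Longrightarrow> b \<in> I \<Longrightarrow> a + b \<in> I"
    using zero_closed a_closed additive_subgroup.zero_closed[OF additive_subgroup_axioms]
      additive_subgroup.a_closed[OF additive_subgroup_axioms] by (simp_all add: free_ring_def)
  have "coset I (D (i + p)) \<subseteq> coset I (D p)" if "i \<in> I" for i
    using that DI Ia by (fastforce simp: c add simp flip: add.assoc)
  moreover have "p \<in> coset I p"
    using I0 by (auto simp: c)
  ultimately show ?thesis
    by (fastforce simp: induced_def c[of p])
qed

definition first_integral :: "free4 set \<Rightarrow> (free4 \<Rightarrow> free4) \<Rightarrow> free4 set \<Rightarrow> bool" where
  "first_integral I D h \<longleftrightarrow>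
     h \<in> carrier (quotient_ring I) \<and> induced I D h = \<zero>\<^bsub>quotient_ring I\<^esub>"

definition commuting :: "free4 set \<Rightarrow> free4 set \<Rightarrow> free4 set \<Rightarrow> bool" where
  "commuting I g h \<longleftrightarrow> g \<otimes>\<^bsub>quotient_ring I\<^esub> h = h \<otimes>\<^bsub>quotient_ring I\<^esub> g"

text \<open>
  \<open>P\<close> is a polynomial in three commuting variables, given by its coefficients at the exponents
  \<open>(a, b, c)\<close>. It is evaluated at pairwise commuting elements, so the order of the factors is
  immaterial.
\<close>

definition eval3 ::
  "free4 set \<Rightarrow> free4 set \<Rightarrow> free4 set \<Rightarrow> free4 set \<Rightarrow> (nat \<times> nat \<times> nat \<Rightarrow>\<^sub>0 complex) \<Rightarrow> free4 set"
where
  "eval3 I h1 h2 h3 P =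
     finsum (quotient_ring I)
       (\<lambda>(a, b, c). coset I (scalar (Poly_Mapping.lookup P (a, b, c)))
          \<otimes>\<^bsub>quotient_ring I\<^esub> (h1 [^]\<^bsub>quotient_ring I\<^esub> a)
          \<otimes>\<^bsub>quotient_ring I\<^esub> (h2 [^]\<^bsub>quotient_ring I\<^esub> b)
          \<otimes>\<^bsub>quotient_ring I\<^esub> (h3 [^]\<^bsub>quotient_ring I\<^esub> c))
       (Poly_Mapping.keys P)"

definition alg_independent3 ::
  "free4 set \<Rightarrow> free4 set \<Rightarrow> free4 set \<Rightarrow> free4 set \<Rightarrow> bool" where
  "alg_independent3 I h1 h2 h3 \<longleftrightarrow>
     (\<forall>P. eval3 I h1 h2 h3 P = \<zero>\<^bsub>quotient_ring I\<^esub> \<longrightarrow> P = 0)"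

text \<open>The four families of commutation constants, with parameter \<open>\<omega>\<close>.\<close>

definition commutation_case :: "(nat \<Rightarrow> nat \<Rightarrow> complex) \<Rightarrow> complex \<Rightarrow> bool" where
  "commutation_case w \<omega> \<longleftrightarrow>
     (w 1 2, w 1 3, w 2 3, w 1 4, w 2 4, w 3 4) \<in>
       {(\<omega>, 1, \<omega>, inverse \<omega>, 1, \<omega>),
        (\<omega>, -1, -\<omega>, -inverse \<omega>, -1, \<omega>),
        (-\<omega>, -1, \<omega>, -inverse \<omega>, 1, \<omega>),
        (-\<omega>, 1, -\<omega>, inverse \<omega>, -1, \<omega>)}"

text \<open>
  The stability condition makes the system on the quotient induced by \<open>D\<close> well defined.
\<close>

definition super_integrable :: "free4 set \<Rightarrow> (free4 \<Rightarrow> free4) \<Rightarrow> bool" where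
  "super_integrable I D \<longleftrightarrow>
     D ` I \<subseteq> I \<and>
     (\<exists>h1 h2 h3. first_integral I D h1 \<and> first_integral I D h2 \<and> first_integral I D h3 \<and>
        commuting I h1 h2 \<and> commuting I h1 h3 \<and> commuting I h2 h3 \<and>
        alg_independent3 I h1 h2 h3)"

end

theory Submission
  imports Defs "HOL-Library.Multiset"
begin

text \<open>
  Sorting words, with a coefficient that records the exchanged letters, defines a linear map on the
  free algebra whose kernel is the quadratic ideal, so membership in the ideal becomes a
  computation. Applied to the time derivatives of the six relations it gives
  \<open>w 1 3 = s\<close>, \<open>w 2 4 = t\<close> with \<open>s\<^sup>2 = t\<^sup>2 = 1\<close>, and all other constants are determined by \<open>s\<close>,
  \<open>t\<close> and \<open>w 3 4\<close>; Hermitian stability says that the constants have modulus 1.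

  In all four cases \<open>u\<^sub>1 + u\<^sub>2 + u\<^sub>3 + u\<^sub>4\<close>, \<open>u\<^sub>1 u\<^sub>3\<close> and \<open>u\<^sub>2 u\<^sub>4\<close> are first integrals. The sum
  commutes with the two products only up to the signs \<open>s\<close> and \<open>t\<close>, so it is replaced by its square.
  Independence follows by comparing parts of maximal weight, where \<open>u\<^sub>1\<close> has weight 1, \<open>u\<^sub>3\<close> has
  weight -1 and the other two generators have weight 0: there the square contributes only \<open>u\<^sub>1\<^sup>2\<close>.
\<close>

section \<open>Normal forms modulo the quadratic ideal\<close>

abbreviation monomial :: "4 list \<Rightarrow> free4" where
  "monomial xs \<equiv> Poly_Mapping.single (Word xs) 1"

lemma gen_monomial: "gen x = monomial [x]"
  by (simp add: gen_def)

lemma monomial_mult: "monomial xs * monomial ys = monomial (xs @ ys)"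
  by (simp add: mult_single plus_fmon_def)

lemma mult_scalar_left: "p * (scalar c * q) = scalar c * (p * q)"
  by (metis mult.assoc scalar_commute)

lemma type4_exhaust: "(x::4) = 1 \<or> x = 2 \<or> x = 3 \<or> x = 0"
proof (cases x)
  case (of_int z)
  then have "z = 0 \<or> z = 1 \<or> z = 2 \<or> z = 3" by auto
  with of_int show ?thesis by auto
qed

text \<open>Index shifts by up to 3, and the natural number 4 read as an index, produce these
  numerals. Reducing them leaves one name per generator.\<close>

lemma type4_numerals: "(4::4) = 0" "(5::4) = 1" "(6::4) = 2"
  by simp_all

text \<open>The representative in 1, ..., 4: it makes u_4, whose index here is 0, the last generator
  and supplies the arguments of \<open>w\<close>.\<close>

definition pos :: "4 \<Rightarrow> nat" where
  "pos x = (if x = 1 then 1 else if x = 2 then 2 else if x = 3 then 3 else 4)"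

lemma pos_simps [simp]: "pos 0 = 4" "pos 1 = 1" "pos 2 = 2" "pos 3 = 3"
  by (simp_all add: pos_def)

lemma of_nat_pos: "of_nat (pos x) = x"
  using type4_exhaust[of x] by auto

lemma pos_range: "1 \<le> pos x" "pos x \<le> 4"
  by (auto simp: pos_def)

lemma pos_of_nat: "1 \<le> i \<Longrightarrow> i \<le> 4 \<Longrightarrow> pos (of_nat i) = i"
  by (subgoal_tac "i = 1 \<or> i = 2 \<or> i = 3 \<or> i = 4") (auto simp: type4_numerals)

section \<open>Sorting words and the coefficient this produces\<close>

definition swap_coeff :: "(nat \<Rightarrow> nat \<Rightarrow> complex) \<Rightarrow> 4 \<Rightarrow> 4 \<Rightarrow> complex" where
  "swap_coeff w x y = (if pos x < pos y then w (pos x) (pos y) else 1)"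

text \<open>One factor for each pair of letters standing against the normal order. Counting
  inversions rather than performed exchanges makes the coefficient independent of any order of
  rewriting, so no overlap conditions on \<open>w\<close> arise.\<close>

fun sort_coeff :: "(nat \<Rightarrow> nat \<Rightarrow> complex) \<Rightarrow> 4 list \<Rightarrow> complex" where
  "sort_coeff w [] = 1"
| "sort_coeff w (x # xs) = prod_list (map (swap_coeff w x) xs) * sort_coeff w xs"

text \<open>The normal order is \<open>u\<^sub>4 u\<^sub>3 u\<^sub>2 u\<^sub>1\<close>; the index of \<open>u\<^sub>4\<close> in \<^typ>\<open>4\<close> is 0.\<close>

definition sort_word :: "4 list \<Rightarrow> 4 list" where
  "sort_word = sort_key (\<lambda>x. 4 - pos x)"

definition normal_form :: "(nat \<Rightarrow> nat \<Rightarrow> complex) \<Rightarrow> free4 \<Rightarrow> free4" where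
  "normal_form w p = (\<Sum>v\<in>Poly_Mapping.keys p.
     Poly_Mapping.single (Word (sort_word (letters v)))
       (Poly_Mapping.lookup p v * sort_coeff w (letters v)))"

lemma normal_form_superset:
  assumes "finite A" "Poly_Mapping.keys p \<subseteq> A"
  shows "normal_form w p = (\<Sum>v\<in>A. Poly_Mapping.single (Word (sort_word (letters v)))
       (Poly_Mapping.lookup p v * sort_coeff w (letters v)))"
  unfolding normal_form_def using assms
  by (intro sum.mono_neutral_left) (auto simp: in_keys_iff)

lemma normal_form_zero: "normal_form w 0 = 0"
  by (simp add: normal_form_def)

lemma normal_form_add: "normal_form w (p + q) = normal_form w p + normal_form w q"
proof -
  let ?A = "Poly_Mapping.keys p \<union> Poly_Mapping.keys q"
  have "Poly_Mapping.keys (p + q) \<subseteq> ?A" by (rule Poly_Mapping.keys_add)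
  then show ?thesis
    using normal_form_superset[of ?A "p + q"] normal_form_superset[of ?A p]
      normal_form_superset[of ?A q]
    by (simp add: lookup_add single_add sum.distrib algebra_simps)
qed

lemma normal_form_single:
  "normal_form w (Poly_Mapping.single v c) =
     Poly_Mapping.single (Word (sort_word (letters v))) (c * sort_coeff w (letters v))"
  using normal_form_superset[of "{v}" "Poly_Mapping.single v c"] by simp

lemma normal_form_uminus: "normal_form w (- p) = - normal_form w p"
  using normal_form_add[of w p "- p"] by (simp add: normal_form_zero eq_neg_iff_add_eq_0 add.commute)

lemma normal_form_diff: "normal_form w (p - q) = normal_form w p - normal_form w q"
  using normal_form_add[of w p "- q"] by (simp add: normal_form_uminus)

lemma normal_form_scalar_mult: "normal_form w (scalar c * p) = scalar c * normal_form w p"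
  by (induction p rule: free4_induct)
     (simp_all add: normal_form_zero normal_form_add normal_form_single scalar_mult_single
        distrib_left mult.assoc)

text \<open>Inversions of a concatenation lie in the first word, in the second, or between the
  two.\<close>

lemma sort_coeff_append:
  "sort_coeff w (xs @ ys) =
     sort_coeff w xs * sort_coeff w ys * (\<Prod>x\<leftarrow>xs. \<Prod>y\<leftarrow>ys. swap_coeff w x y)"
  by (induction xs) (simp_all add: algebra_simps)

lemma mset_sort_word [simp]: "mset (sort_word xs) = mset xs"
  by (simp add: sort_word_def)

lemma prod_list_mset_cong:
  assumes "mset xs = mset ys"
  shows "prod_list (map f xs) = prod_list (map (f :: _ \<Rightarrow> 'b::comm_monoid_mult) ys)"
  by (metis assms mset_map prod_mset_prod_list)

text \<open>The sorting key is injective on the four letters, so a stable sort retains no trace of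
  the original order.\<close>

lemma sort_word_cong:
  assumes "mset xs = mset ys"
  shows "sort_word xs = sort_word ys"
  unfolding sort_word_def
proof (rule sort_key_inj_key_eq)
  show "inj_on (\<lambda>x. 4 - pos x) (set xs)"
    by (rule inj_onI) (metis diff_diff_cancel of_nat_pos pos_range(2))
qed (use assms in simp_all)

lemma sort_coeff_sort_word: "sort_coeff w (sort_word xs) = 1"
proof -
  have "sort_coeff w ys = 1" if "sorted (map (\<lambda>x. 4 - pos x) ys)" for ys
    using that
  proof (induction ys)
    case (Cons y ys)
    have "swap_coeff w y z = 1" if "z \<in> set ys" for z
      using Cons.prems that pos_range(2)[of y] pos_range(2)[of z] by (auto simp: swap_coeff_def)
    then have "map (swap_coeff w y) ys = map (\<lambda>_. 1) ys"
      by auto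
    then show ?case
      using Cons by (simp add: map_replicate_const)
  qed simp
  then show ?thesis
    by (simp add: sort_word_def)
qed

text \<open>
  The cost of moving one word past another depends only on their multisets of letters, so both
  factors can be sorted first.
\<close>

lemma normal_form_mult:
  "normal_form w (p * q) = normal_form w (normal_form w p * normal_form w q)"
proof (induction p rule: free4_induct)
  case (single u a)
  show ?case
  proof (induction q rule: free4_induct)
    case (single v b)
    let ?xs = "letters u" and ?ys = "letters v"
    have "(\<Prod>x\<leftarrow>sort_word ?xs. \<Prod>y\<leftarrow>sort_word ?ys. swap_coeff w x y) =
        (\<Prod>x\<leftarrow>?xs. \<Prod>y\<leftarrow>?ys. swap_coeff w x y)"
      by (simp add: prod_list_mset_cong[OF mset_sort_word])
    moreover have "sort_word (sort_word ?xs @ sort_word ?ys) = sort_word (?xs @ ?ys)"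
      by (rule sort_word_cong) simp
    ultimately show ?case
      by (simp add: normal_form_single mult_single plus_fmon_def sort_coeff_append
          sort_coeff_sort_word mult_ac)
  qed (simp_all add: normal_form_zero normal_form_add distrib_left)
qed (simp_all add: normal_form_zero normal_form_add distrib_right)

section \<open>The quadratic ideal as the kernel of the normal form\<close>

lemma ideal_free_ringI:
  assumes "0 \<in> I" "\<And>p q. p \<in> I \<Longrightarrow> q \<in> I \<Longrightarrow> p + q \<in> I"
    "\<And>r p. p \<in> I \<Longrightarrow> r * p \<in> I" "\<And>r p. p \<in> I \<Longrightarrow> p * r \<in> I"
  shows "ideal I free_ring"
proof (rule idealI[OF ring_free_ring])
  interpret ring free_ring by (rule ring_free_ring)
  show "subgroup I (add_monoid free_ring)"
  proof (rule add.subgroupI)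
    fix p assume p: "p \<in> I"
    have "\<ominus>\<^bsub>free_ring\<^esub> p = - p"
      by (rule minus_equality) (simp_all add: free_ring_def)
    moreover have "- p \<in> I"
      using assms(3)[OF p, of "- 1"] by simp
    ultimately show "\<ominus>\<^bsub>free_ring\<^esub> p \<in> I"
      by simp
  qed (use assms(1,2) in \<open>auto simp: free_ring_def\<close>)
qed (use assms in \<open>simp_all add: free_ring_def\<close>)

lemma quad_ideal_zero: "0 \<in> quad_ideal w"
  and quad_ideal_add: "p \<in> quad_ideal w \<Longrightarrow> q \<in> quad_ideal w \<Longrightarrow> p + q \<in> quad_ideal w"
  and quad_ideal_mult_left: "p \<in> quad_ideal w \<Longrightarrow> r * p \<in> quad_ideal w"
  and quad_ideal_mult_right: "p \<in> quad_ideal w \<Longrightarrow> p * r \<in> quad_ideal w"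
proof -
  interpret ideal "quad_ideal w" free_ring by (rule ideal_quad_ideal)
  show "0 \<in> quad_ideal w"
    using additive_subgroup.zero_closed[OF additive_subgroup_axioms] by (simp add: free_ring_def)
  show "p \<in> quad_ideal w \<Longrightarrow> q \<in> quad_ideal w \<Longrightarrow> p + q \<in> quad_ideal w"
    using additive_subgroup.a_closed[OF additive_subgroup_axioms] by (simp add: free_ring_def)
  show "p \<in> quad_ideal w \<Longrightarrow> r * p \<in> quad_ideal w"
    using I_l_closed[of p r] by (simp add: free_ring_def)
  show "p \<in> quad_ideal w \<Longrightarrow> p * r \<in> quad_ideal w"
    using I_r_closed[of p r] by (simp add: free_ring_def)
qed

definition relator :: "(nat \<Rightarrow> nat \<Rightarrow> complex) \<Rightarrow> nat \<Rightarrow> nat \<Rightarrow> free4" where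
  "relator w i j = gen (of_nat i) * gen (of_nat j) - scalar (w i j) * gen (of_nat j) * gen (of_nat i)"

lemma relator_in_quad_ideal:
  assumes "1 \<le> i" "i < j" "j \<le> 4"
  shows "relator w i j \<in> quad_ideal w"
proof -
  interpret ring free_ring by (rule ring_free_ring)
  have "{gen (of_nat i) * gen (of_nat j) - scalar (w i j) * gen (of_nat j) * gen (of_nat i) | i j.
        1 \<le> i \<and> i < j \<and> j \<le> 4} \<subseteq> quad_ideal w"
    unfolding quad_ideal_def by (rule genideal_self) (simp add: free_ring_def)
  then show ?thesis
    using assms by (auto simp: relator_def)
qed

lemma quad_ideal_minimal:
  assumes "ideal J free_ring" "\<And>i j. 1 \<le> i \<Longrightarrow> i < j \<Longrightarrow> j \<le> 4 \<Longrightarrow> relator w i j \<in> J"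
  shows "quad_ideal w \<subseteq> J"
proof -
  interpret ring free_ring by (rule ring_free_ring)
  show ?thesis
    unfolding quad_ideal_def
    by (rule genideal_minimal) (use assms in \<open>auto simp: relator_def\<close>)
qed

lemma sort_word_Cons: "sort_word (x # xs) = insort_key (\<lambda>x. 4 - pos x) x (sort_word xs)"
  by (simp add: sort_word_def)

lemma monomial_Cons: "monomial (x # xs) = gen x * monomial xs"
  by (simp add: gen_monomial monomial_mult)

text \<open>The new letter travels right one place at a time, each exchange being a multiple of one
  relator. Where the insertion stops, sortedness makes all remaining factors 1, so the product over
  the whole of \<open>ys\<close> is the cost actually paid.\<close>

lemma insort_congruent:
  assumes "sorted (map (\<lambda>x. 4 - pos x) ys)"
  shows "monomial (x # ys) -
    scalar (prod_list (map (swap_coeff w x) ys)) * monomial (insort_key (\<lambda>x. 4 - pos x) x ys)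
    \<in> quad_ideal w"
  using assms
proof (induction ys)
  case Nil
  then show ?case by (simp add: scalar_simps quad_ideal_zero)
next
  case (Cons y ys)
  show ?case
  proof (cases "4 - pos x \<le> 4 - pos y")
    case True
    have "swap_coeff w x z = 1" if "z \<in> set (y # ys)" for z
      using Cons.prems True that pos_range(2)[of y] pos_range(2)[of z] pos_range(2)[of x]
      by (auto simp: swap_coeff_def)
    then have "map (swap_coeff w x) (y # ys) = map (\<lambda>_. 1) (y # ys)"
      by auto
    then have "prod_list (map (swap_coeff w x) (y # ys)) = 1"
      by (simp add: map_replicate_const)
    then show ?thesis
      using True by (simp add: scalar_simps quad_ideal_zero)
  next
    case False
    then have less: "pos x < pos y"
      by linarith
    let ?c = "prod_list (map (swap_coeff w x) ys)" and ?zs = "insort_key (\<lambda>x. 4 - pos x) x ys"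
    have "relator w (pos x) (pos y) \<in> quad_ideal w"
      using less pos_range[of x] pos_range[of y] by (intro relator_in_quad_ideal) auto
    then have 1: "(gen x * gen y - scalar (swap_coeff w x y) * gen y * gen x) * monomial ys \<in> quad_ideal w"
      using less by (simp add: relator_def of_nat_pos swap_coeff_def quad_ideal_mult_right)
    have 2: "scalar (swap_coeff w x y) * gen y * (monomial (x # ys) - scalar ?c * monomial ?zs)
        \<in> quad_ideal w"
      using Cons by (intro quad_ideal_mult_left) simp
    \<comment> \<open>Exchange the first two letters, then continue the insertion in the
      tail.\<close>
    have "monomial (x # y # ys) -
        scalar (swap_coeff w x y * ?c) * monomial (y # ?zs) =
      (gen x * gen y - scalar (swap_coeff w x y) * gen y * gen x) * monomial ys +
      scalar (swap_coeff w x y) * gen y * (monomial (x # ys) - scalar ?c * monomial ?zs)"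
      by (simp add: monomial_Cons scalar_simps mult_scalar_left[of "gen y"] algebra_simps)
    with quad_ideal_add[OF 1 2] False show ?thesis
      by simp
  qed
qed

text \<open>Insertion sort: reduce the tail first, then insert the head. The insertion cost is a
  product over a multiset, hence the same for the tail and for its sorted form.\<close>

lemma monomial_congruent:
  "monomial xs - scalar (sort_coeff w xs) * monomial (sort_word xs) \<in> quad_ideal w"
proof (induction xs)
  case Nil
  then show ?case by (simp add: scalar_simps sort_word_def quad_ideal_zero)
next
  case (Cons x xs)
  let ?c = "prod_list (map (swap_coeff w x) xs)" and ?d = "sort_coeff w xs"
  have "monomial (x # sort_word xs) -
      scalar (prod_list (map (swap_coeff w x) (sort_word xs))) * monomial (sort_word (x # xs))
      \<in> quad_ideal w"
    unfolding sort_word_Cons by (rule insort_congruent) (simp add: sort_word_def)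
  then have 1: "scalar ?d * (monomial (x # sort_word xs) - scalar ?c * monomial (sort_word (x # xs)))
      \<in> quad_ideal w"
    by (simp add: prod_list_mset_cong[OF mset_sort_word] quad_ideal_mult_left)
  have 2: "gen x * (monomial xs - scalar ?d * monomial (sort_word xs)) \<in> quad_ideal w"
    by (rule quad_ideal_mult_left[OF Cons])
  have "monomial (x # xs) - scalar (?c * ?d) * monomial (sort_word (x # xs)) =
      scalar ?d * (monomial (x # sort_word xs) - scalar ?c * monomial (sort_word (x # xs))) +
      gen x * (monomial xs - scalar ?d * monomial (sort_word xs))"
    by (simp add: monomial_Cons scalar_simps mult_scalar_left[of "gen x"]
        mult_scalar_left[of "scalar ?c"] algebra_simps)
  with quad_ideal_add[OF 1 2] show ?case
    by simp
qed

lemma normal_form_congruent: "p - normal_form w p \<in> quad_ideal w"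
proof (induction p rule: free4_induct)
  case zero
  show ?case by (simp add: normal_form_zero quad_ideal_zero)
next
  case (single v c)
  have "Poly_Mapping.single v c - normal_form w (Poly_Mapping.single v c) =
    scalar c * (monomial (letters v) - scalar (sort_coeff w (letters v)) * monomial (sort_word (letters v)))"
    by (simp add: normal_form_single scalar_mult_single right_diff_distrib)
  then show ?case
    by (simp only: quad_ideal_mult_left[OF monomial_congruent])
next
  case (add p q)
  have "p + q - normal_form w (p + q) = (p - normal_form w p) + (q - normal_form w q)"
    by (simp add: normal_form_add)
  then show ?case
    by (simp only: quad_ideal_add[OF add])
qed

lemma normal_form_relator:
  assumes "1 \<le> i" "i < j" "j \<le> 4"
  shows "normal_form w (relator w i j) = 0"
proof -
  have "pos (of_nat i) = i" "pos (of_nat j) = j"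
    using assms by (auto intro: pos_of_nat)
  moreover have "4 - i \<noteq> 4 - j"
    using assms by linarith
  ultimately show ?thesis
    using assms
    by (simp add: relator_def gen_def mult_single plus_fmon_def scalar_mult_single normal_form_diff
        normal_form_single sort_word_def swap_coeff_def)
qed

text \<open>By \<open>normal_form_mult\<close> the kernel is a two-sided ideal, and it contains the
  relators, hence the ideal they generate. Conversely, an element differs from its normal form by an
  element of the ideal.\<close>

lemma quad_ideal_iff: "p \<in> quad_ideal w \<longleftrightarrow> normal_form w p = 0"
proof
  have "ideal {p. normal_form w p = 0} free_ring"
  proof (rule ideal_free_ringI)
    fix r p assume "p \<in> {p. normal_form w p = 0}"
    then show "r * p \<in> {p. normal_form w p = 0}" "p * r \<in> {p. normal_form w p = 0}"
      using normal_form_mult[of w r p] normal_form_mult[of w p r] by (simp_all add: normal_form_zero)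
  qed (simp_all add: normal_form_zero normal_form_add)
  then have "quad_ideal w \<subseteq> {p. normal_form w p = 0}"
    by (rule quad_ideal_minimal) (simp add: normal_form_relator)
  then show "p \<in> quad_ideal w \<Longrightarrow> normal_form w p = 0"
    by blast
next
  show "normal_form w p = 0 \<Longrightarrow> p \<in> quad_ideal w"
    using normal_form_congruent[of p w] by simp
qed

section \<open>Time derivatives of the relations\<close>

text \<open>The flow without the factor \<open>q\<^sup>2\<close>, which affects neither stability nor first integrals.\<close>

definition flow_rate :: "4 \<Rightarrow> free4" where
  "flow_rate n = gen (n + 2) * gen (n + 1) * gen n + gen (n + 1) ^ 2 * gen n + gen (n + 1) * gen n ^ 2
        - gen n ^ 2 * gen (n + 3) - gen n * gen (n + 3) * gen (n + 2) - gen n * gen (n + 3) ^ 2"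

definition flow :: "free4 \<Rightarrow> free4" where
  "flow = derivation flow_rate"

text \<open>Scalars are central, so the factor can be pulled through the Leibniz rule.\<close>

lemma derivation_scale:
  "derivation (\<lambda>n. scalar c * d n) p = scalar c * derivation d p"
proof -
  have "der_word (\<lambda>n. scalar c * d n) xs = scalar c * der_word d xs" for xs
  proof (induction xs)
    case (Cons x xs)
    then show ?case
      by (simp add: mult_scalar_left[of "gen x"] algebra_simps)
  qed simp
  then show ?thesis
    by (simp add: derivation_def sum_distrib_left mult_scalar_left[of "scalar (Poly_Mapping.lookup _ _)"])
qed

lemma volterra2_flow: "volterra2 h p = scalar (exp (\<i> * complex_of_real h) ^ 2) * flow p"
  unfolding volterra2_def flow_def flow_rate_def by (rule derivation_scale)

lemma derivation_uminus: "derivation d (- p) = - derivation d p"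
  using derivation_add[of d p "- p"]
  by (simp add: derivation_zero eq_neg_iff_add_eq_0 add.commute)

lemma derivation_diff: "derivation d (p - q) = derivation d p - derivation d q"
  using derivation_add[of d p "- q"] by (simp add: derivation_uminus)

lemma normal_form_scalar_mult_eq_0:
  assumes "c \<noteq> 0"
  shows "normal_form w (scalar c * p) = 0 \<longleftrightarrow> normal_form w p = 0"
proof
  assume "normal_form w (scalar c * p) = 0"
  then have "scalar (inverse c) * (scalar c * normal_form w p) = 0"
    by (simp add: normal_form_scalar_mult)
  then show "normal_form w p = 0"
    using assms by (simp add: scalar_simps(2) flip: mult.assoc scalar_simps(4))
qed (simp add: normal_form_scalar_mult)

lemma volterra2_in_quad_ideal_iff: "volterra2 h p \<in> quad_ideal w \<longleftrightarrow> flow p \<in> quad_ideal w"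
  by (simp add: volterra2_flow quad_ideal_iff normal_form_scalar_mult_eq_0)

lemma flow_rate_monomials:
  "flow_rate 0 = monomial [2,1,0] + monomial [1,1,0] + monomial [1,0,0]
     - monomial [0,0,3] - monomial [0,3,2] - monomial [0,3,3]"
  "flow_rate 1 = monomial [3,2,1] + monomial [2,2,1] + monomial [2,1,1]
     - monomial [1,1,0] - monomial [1,0,3] - monomial [1,0,0]"
  "flow_rate 2 = monomial [0,3,2] + monomial [3,3,2] + monomial [3,2,2]
     - monomial [2,2,1] - monomial [2,1,0] - monomial [2,1,1]"
  "flow_rate 3 = monomial [1,0,3] + monomial [0,0,3] + monomial [0,3,3]
     - monomial [3,3,2] - monomial [3,2,1] - monomial [3,2,2]"
  by (simp_all add: flow_rate_def gen_monomial monomial_mult power2_eq_square type4_numerals)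

lemma flow_relator:
  "flow (relator w i j) =
     flow_rate (of_nat i) * gen (of_nat j) + gen (of_nat i) * flow_rate (of_nat j)
     - scalar (w i j) * (flow_rate (of_nat j) * gen (of_nat i) + gen (of_nat j) * flow_rate (of_nat i))"
  by (simp add: flow_def relator_def derivation_diff derivation_mult derivation_scalar derivation_gen
      algebra_simps)

lemmas normal_form_eval =
  gen_monomial monomial_mult mult_single plus_fmon_def scalar_mult_single
  normal_form_add normal_form_diff normal_form_zero normal_form_single
  sort_word_def swap_coeff_def type4_numerals

text \<open>In this and the next five expansions the words are distinct, so the derivative of the
  relation lies in the ideal exactly when every listed coefficient vanishes. The pairs (1,2) and
  (3,4) later supply the equations for the constants; all six serve to verify the four
  cases.\<close>

lemma normal_form_flow_relator_12:
  "normal_form w (flow (relator w 1 2)) =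
     Poly_Mapping.single (Word [3, 2, 2, 1]) (w 1 2^2 * w 1 3 - w 1 2 * w 2 3) +
     Poly_Mapping.single (Word [0, 2, 1, 1]) (w 1 2 * w 1 4 * w 2 4 - w 1 2^2 * w 1 4^2) +
     Poly_Mapping.single (Word [0, 3, 2, 1]) (w 1 2 * w 1 3 * w 1 4 * w 2 3 * w 2 4 - w 1 2) +
     Poly_Mapping.single (Word [0, 0, 2, 1]) (w 1 2 * w 1 4^2 * w 2 4^2 - w 1 2 * w 1 4^2) +
     Poly_Mapping.single (Word [3, 3, 2, 1]) (w 1 2 * w 1 3^2 - w 1 2)"
  by (simp add: flow_relator flow_rate_monomials normal_form_eval single_diff
      algebra_simps power2_eq_square)

lemma normal_form_flow_relator_13:
  "normal_form w (flow (relator w 1 3)) =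
     Poly_Mapping.single (Word [3, 3, 2, 1]) (w 1 3 * w 2 3 - w 1 2 * w 1 3^2) +
     Poly_Mapping.single (Word [3, 2, 2, 1]) (w 1 3 * w 2 3^2 - w 1 2^2 * w 1 3) +
     Poly_Mapping.single (Word [3, 2, 1, 1]) (w 1 3^2 * w 2 3 - w 1 2 * w 1 3) +
     Poly_Mapping.single (Word [0, 3, 1, 1]) (w 1 3 * w 1 4^2 * w 3 4 - w 1 3^2 * w 1 4) +
     Poly_Mapping.single (Word [0, 3, 3, 1]) (w 1 3^2 * w 1 4 * w 3 4 - w 1 3) +
     Poly_Mapping.single (Word [0, 0, 3, 1]) (w 1 3 * w 1 4^2 * w 3 4^2 - w 1 3)"
  by (simp add: flow_relator flow_rate_monomials normal_form_eval single_diff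
      algebra_simps power2_eq_square)

lemma normal_form_flow_relator_14:
  "normal_form w (flow (relator w 1 4)) =
     Poly_Mapping.single (Word [0, 3, 2, 1]) (w 1 4 * w 2 4 * w 3 4 - w 1 2 * w 1 3 * w 1 4) +
     Poly_Mapping.single (Word [0, 2, 2, 1]) (w 1 4 * w 2 4^2 - w 1 4) +
     Poly_Mapping.single (Word [0, 2, 1, 1]) (w 1 2 * w 1 4^2 * w 2 4 - w 1 4) +
     Poly_Mapping.single (Word [0, 0, 3, 1]) (w 1 4 - w 1 3 * w 1 4^2 * w 3 4) +
     Poly_Mapping.single (Word [0, 3, 3, 1]) (w 1 4 - w 1 3^2 * w 1 4)"
  by (simp add: flow_relator flow_rate_monomials normal_form_eval single_diff
      algebra_simps power2_eq_square)

lemma normal_form_flow_relator_23: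
  "normal_form w (flow (relator w 2 3)) =
     Poly_Mapping.single (Word [0, 3, 3, 2]) (w 2 3^2 * w 2 4 - w 2 3 * w 3 4) +
     Poly_Mapping.single (Word [3, 2, 2, 1]) (w 1 2 * w 2 3 - w 1 3 * w 2 3^2) +
     Poly_Mapping.single (Word [0, 3, 2, 1]) (w 1 4 * w 2 3 * w 2 4 * w 3 4 - w 1 2 * w 1 3 * w 1 4 * w 2 3) +
     Poly_Mapping.single (Word [3, 2, 1, 1]) (w 2 3 - w 1 3^2 * w 2 3) +
     Poly_Mapping.single (Word [0, 0, 3, 2]) (w 2 3 * w 2 4^2 - w 2 3)"
  by (simp add: flow_relator flow_rate_monomials normal_form_eval single_diff
      algebra_simps power2_eq_square)

lemma normal_form_flow_relator_24:
  "normal_form w (flow (relator w 2 4)) =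
     Poly_Mapping.single (Word [0, 0, 3, 2]) (w 2 4 * w 3 4 - w 2 3 * w 2 4^2) +
     Poly_Mapping.single (Word [0, 3, 3, 2]) (w 2 4 * w 3 4^2 - w 2 3^2 * w 2 4) +
     Poly_Mapping.single (Word [0, 3, 2, 2]) (w 2 4^2 * w 3 4 - w 2 3 * w 2 4) +
     Poly_Mapping.single (Word [0, 2, 2, 1]) (w 2 4 - w 1 2 * w 1 4 * w 2 4^2) +
     Poly_Mapping.single (Word [0, 0, 2, 1]) (w 1 4 * w 2 4^2 - w 1 2 * w 1 4^2 * w 2 4) +
     Poly_Mapping.single (Word [0, 2, 1, 1]) (w 2 4 - w 1 2^2 * w 1 4^2 * w 2 4)"
  by (simp add: flow_relator flow_rate_monomials normal_form_eval single_diff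
      algebra_simps power2_eq_square)

lemma normal_form_flow_relator_34:
  "normal_form w (flow (relator w 3 4)) =
     Poly_Mapping.single (Word [0, 0, 3, 1]) (w 1 4^2 * w 3 4^2 - w 1 3 * w 1 4 * w 3 4) +
     Poly_Mapping.single (Word [0, 3, 3, 2]) (w 2 3 * w 3 4 - w 2 4 * w 3 4^2) +
     Poly_Mapping.single (Word [0, 3, 2, 1]) (w 3 4 - w 1 3 * w 1 4 * w 2 3 * w 2 4 * w 3 4) +
     Poly_Mapping.single (Word [0, 3, 2, 2]) (w 3 4 - w 2 4^2 * w 3 4) +
     Poly_Mapping.single (Word [0, 3, 1, 1]) (w 1 4^2 * w 3 4 - w 1 3^2 * w 1 4^2 * w 3 4)"
  by (simp add: flow_relator flow_rate_monomials normal_form_eval single_diff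
      algebra_simps power2_eq_square)

section \<open>Stability\<close>

lemma dagger_uminus: "dagger (- p) = - dagger p"
  using dagger_add[of p "- p"] by (simp add: dagger_zero eq_neg_iff_add_eq_0 add.commute)

lemma dagger_diff: "dagger (p - q) = dagger p - dagger q"
  using dagger_add[of p "- q"] by (simp add: dagger_uminus)

lemma dagger_dagger: "dagger (dagger p) = p"
  by (induction p rule: free4_induct) (simp_all add: dagger_zero dagger_single dagger_add)

text \<open>Conjugation reverses both products and conjugates the constant; sorting the term now out
  of order costs a factor \<open>w i j\<close>. A relation therefore survives conjugation exactly
  when its constant has modulus 1.\<close>

lemma normal_form_dagger_relator:
  assumes "1 \<le> i" "i < j" "j \<le> 4"
  shows "normal_form w (dagger (relator w i j)) =
    Poly_Mapping.single (Word [of_nat j, of_nat i]) (1 - cnj (w i j) * w i j)"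
proof -
  have "pos (of_nat i) = i" "pos (of_nat j) = j"
    using assms by (auto intro: pos_of_nat)
  moreover have "4 - j < 4 - i"
    using assms by linarith
  moreover have "dagger (relator w i j) =
      gen (of_nat j) * gen (of_nat i) - gen (of_nat i) * gen (of_nat j) * scalar (cnj (w i j))"
    by (simp add: relator_def dagger_diff dagger_mult dagger_gen dagger_scalar mult.assoc)
  ultimately show ?thesis
    using assms
    by (simp add: gen_def mult_single
        plus_fmon_def single_mult_scalar normal_form_diff normal_form_single sort_word_def
        swap_coeff_def single_diff mult.commute)
qed

lemma norm_eq_1_iff_cnj: "norm z = 1 \<longleftrightarrow> cnj z * z = 1"
  by (metis (no_types, lifting) complex_norm_square mult.commute norm_ge_zero of_real_eq_1_iff
      power2_eq_1_iff power_one neg_0_le_iff_le not_one_le_zero)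

section \<open>Necessity: from stability to the four cases\<close>

lemma commutation_case_if_stable:
  assumes nz: "\<And>i j. 1 \<le> i \<Longrightarrow> i < j \<Longrightarrow> j \<le> 4 \<Longrightarrow> w i j \<noteq> 0"
    and flow: "\<And>i j. 1 \<le> i \<Longrightarrow> i < j \<Longrightarrow> j \<le> 4 \<Longrightarrow> flow (relator w i j) \<in> quad_ideal w"
  shows "commutation_case w (w 3 4)"
proof -
  have nonzero: "w 1 2 \<noteq> 0" "w 1 4 \<noteq> 0" "w 2 4 \<noteq> 0" "w 3 4 \<noteq> 0" "w 2 3 \<noteq> 0"
    using nz by simp_all
  have coeff: "Poly_Mapping.lookup (normal_form w (flow (relator w 1 2))) v = 0"
    "Poly_Mapping.lookup (normal_form w (flow (relator w 3 4))) v = 0" for v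
    using flow[of 1 2] flow[of 3 4] by (simp_all add: quad_ideal_iff)
  \<comment> \<open>Each coefficient inspected here is a nonzero product of constants times the
    difference of the two sides of the wanted equation.\<close>
  have "w 1 2 * w 1 3 = w 2 3"
    using coeff(1)[of "Word [3, 2, 2, 1]"] nonzero
    unfolding normal_form_flow_relator_12
    by (simp add: lookup_add lookup_single when_def power2_eq_square)
  moreover have "w 1 3 ^ 2 = 1"
    using coeff(1)[of "Word [3, 3, 2, 1]"] nonzero
    unfolding normal_form_flow_relator_12 by (simp add: lookup_add lookup_single when_def)
  moreover have "w 2 4 ^ 2 = 1"
    using coeff(1)[of "Word [0, 0, 2, 1]"] nonzero
    unfolding normal_form_flow_relator_12 by (simp add: lookup_add lookup_single when_def)
  moreover have "w 1 4 * w 3 4 = w 1 3"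
    using coeff(2)[of "Word [0, 0, 3, 1]"] nonzero
    unfolding normal_form_flow_relator_34
    by (simp add: lookup_add lookup_single when_def power2_eq_square)
  moreover have "w 2 3 = w 2 4 * w 3 4"
    using coeff(2)[of "Word [0, 3, 3, 2]"] nonzero
    unfolding normal_form_flow_relator_34
    by (simp add: lookup_add lookup_single when_def power2_eq_square)
  \<comment> \<open>Multiply the first equation by \<open>w 1 3\<close>, whose square is 1.\<close>
  moreover from calculation(1,2) have "w 1 2 = w 1 3 * w 2 3"
    by (metis mult.assoc mult.commute mult_1 power2_eq_square)
  \<comment> \<open>Two signs and \<open>w 3 4\<close> remain free. Equal signs give the first two
    families, opposite signs the last two.\<close>
  ultimately have
    "w 1 3 = 1 \<or> w 1 3 = -1" "w 2 4 = 1 \<or> w 2 4 = -1"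
    "w 2 3 = w 2 4 * w 3 4" "w 1 4 = w 1 3 * inverse (w 3 4)" "w 1 2 = w 1 3 * w 2 4 * w 3 4"
    using nonzero by (auto simp: power2_eq_1_iff field_simps)
  then show ?thesis
    by (elim disjE) (simp_all add: commutation_case_def)
qed

section \<open>Sufficiency: from the four cases to stability\<close>

lemma index_pairs:
  assumes "1 \<le> i" "i < j" "j \<le> (4::nat)"
  shows "(i, j) \<in> {(1,2), (1,3), (1,4), (2,3), (2,4), (3,4)}"
  using assms by (cases "i = 1"; cases "i = 2"; cases "i = 3") auto

text \<open>The signs \<open>s\<close> and \<open>t\<close> treat the four cases at once. The
  inverse of \<omega> is kept as a variable \<open>v\<close>, so that later coefficients are plain
  monomials reduced by three unit relations.\<close>

lemma commutation_caseE:
  assumes "commutation_case w \<omega>" "\<omega> \<noteq> 0"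
  obtains s t v where "s * s = 1" "t * t = 1" "\<omega> * v = 1"
    "w 1 2 = s * t * \<omega>" "w 1 3 = s" "w 2 3 = t * \<omega>" "w 1 4 = s * v" "w 2 4 = t" "w 3 4 = \<omega>"
  using assms that[of 1 1 "inverse \<omega>"] that[of "-1" "-1" "inverse \<omega>"]
    that[of "-1" 1 "inverse \<omega>"] that[of 1 "-1" "inverse \<omega>"]
  by (auto simp: commutation_case_def)

text \<open>The shapes in which a unit pair occurs after sorting the factors of a product.\<close>

lemma mult_cancel_unit:
  assumes "a * b = (1 :: 'a :: comm_monoid_mult)"
  shows "a * (b * c) = c" "a * (c * b) = c" "a * (c * (b * d)) = c * d"
    "a * (c * (d * b)) = c * d"
  using assms by (metis mult.assoc mult.commute mult_1)+

lemma flow_relator_in_quad_ideal: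
  assumes "commutation_case w \<omega>" "\<omega> \<noteq> 0" "1 \<le> i" "i < j" "j \<le> 4"
  shows "flow (relator w i j) \<in> quad_ideal w"
proof -
  obtain s t v where unit: "s * s = 1" "t * t = 1" "\<omega> * v = 1"
    and w: "w 1 2 = s * t * \<omega>" "w 1 3 = s" "w 2 3 = t * \<omega>" "w 1 4 = s * v" "w 2 4 = t" "w 3 4 = \<omega>"
    using commutation_caseE[OF assms(1,2)] .
  \<comment> \<open>After substitution every coefficient is a difference of two monomials that the
    unit relations make equal.\<close>
  have "normal_form w (flow (relator w 1 2)) = 0" "normal_form w (flow (relator w 1 3)) = 0"
    "normal_form w (flow (relator w 1 4)) = 0" "normal_form w (flow (relator w 2 3)) = 0"
    "normal_form w (flow (relator w 2 4)) = 0" "normal_form w (flow (relator w 3 4)) = 0"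
    unfolding normal_form_flow_relator_12 normal_form_flow_relator_13 normal_form_flow_relator_14
      normal_form_flow_relator_23 normal_form_flow_relator_24 normal_form_flow_relator_34 w
    by (simp_all add: power2_eq_square mult_ac unit mult_cancel_unit[OF unit(1)]
        mult_cancel_unit[OF unit(2)] mult_cancel_unit[OF unit(3)])
  then show ?thesis
    using index_pairs[OF assms(3-5)] by (auto simp: quad_ideal_iff)
qed

text \<open>The elements of the ideal whose derivative stays in it form a two-sided ideal: the term
  \<open>flow r * p\<close> of the Leibniz rule is absorbed because \<open>p\<close> itself lies in
  the ideal. Hence it suffices to check the relators.\<close>

lemma flow_quad_ideal:
  assumes "commutation_case w \<omega>" "\<omega> \<noteq> 0"
  shows "flow ` quad_ideal w \<subseteq> quad_ideal w"
proof -
  have "quad_ideal w \<subseteq> {p \<in> quad_ideal w. flow p \<in> quad_ideal w}"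
    by (intro quad_ideal_minimal ideal_free_ringI)
      (use flow_relator_in_quad_ideal[OF assms] in \<open>auto simp: relator_in_quad_ideal flow_def
        derivation_zero derivation_add derivation_mult
        intro: quad_ideal_zero quad_ideal_add quad_ideal_mult_left quad_ideal_mult_right\<close>)
  then show ?thesis
    by blast
qed

text \<open>Again the relators suffice, now because conjugation exchanges left and right multiples.
  Being an involution, it maps the ideal onto itself once it maps it into itself.\<close>

lemma dagger_quad_ideal:
  assumes "\<And>i j. 1 \<le> i \<Longrightarrow> i < j \<Longrightarrow> j \<le> 4 \<Longrightarrow> norm (w i j) = 1"
  shows "dagger ` quad_ideal w = quad_ideal w"
proof -
  have "dagger (relator w i j) \<in> quad_ideal w" if "1 \<le> i" "i < j" "j \<le> 4" for i j
    using assms[OF that] by (simp add: quad_ideal_iff normal_form_dagger_relator[OF that] norm_eq_1_iff_cnj)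
  then have "quad_ideal w \<subseteq> {p \<in> quad_ideal w. dagger p \<in> quad_ideal w}"
    by (intro quad_ideal_minimal ideal_free_ringI)
      (auto simp: relator_in_quad_ideal dagger_zero dagger_add dagger_mult
        intro: quad_ideal_zero quad_ideal_add quad_ideal_mult_left quad_ideal_mult_right)
  moreover have "p \<in> dagger ` quad_ideal w" if "dagger p \<in> quad_ideal w" for p
    using that by (metis dagger_dagger imageI)
  ultimately show ?thesis
    by blast
qed

lemma norm_commutation_case:
  assumes "commutation_case w \<omega>" "norm \<omega> = 1" "1 \<le> i" "i < j" "j \<le> 4"
  shows "norm (w i j) = 1"
  using index_pairs[OF assms(3-5)] assms(1,2)
  by (auto simp: commutation_case_def norm_inverse)

lemma stable_iff_commutation_case:
  assumes nz: "\<And>i j. 1 \<le> i \<Longrightarrow> i < j \<Longrightarrow> j \<le> 4 \<Longrightarrow> w i j \<noteq> 0"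
  shows "flow ` quad_ideal w \<subseteq> quad_ideal w \<and> dagger ` quad_ideal w = quad_ideal w
    \<longleftrightarrow> (\<exists>h::real. commutation_case w (exp (2 * \<i> * complex_of_real h)))"
proof
  assume stable: "flow ` quad_ideal w \<subseteq> quad_ideal w \<and> dagger ` quad_ideal w = quad_ideal w"
  then have comm: "commutation_case w (w 3 4)"
    using relator_in_quad_ideal by (intro commutation_case_if_stable nz) blast+
  \<comment> \<open>For this pair, stability under conjugation makes \<open>w 3 4\<close> a
    phase.\<close>
  have "dagger (relator w 3 4) \<in> quad_ideal w"
    using stable relator_in_quad_ideal[of 3 4 w] by auto
  then have "Poly_Mapping.single (Word [of_nat 4, of_nat 3]) (1 - cnj (w 3 4) * w 3 4) = (0 :: free4)"
    using normal_form_dagger_relator[of 3 4 w] by (simp add: quad_ideal_iff)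
  then have "cnj (w 3 4) * w 3 4 = 1"
    by (metis eq_iff_diff_eq_0 lookup_single_eq lookup_zero)
  then have "norm (w 3 4) = 1"
    by (simp add: norm_eq_1_iff_cnj)
  then have "cis (Arg (w 3 4)) = w 3 4"
    using cis_Arg[of "w 3 4"] nz[of 3 4] by (simp add: sgn_div_norm)
  \<comment> \<open>Half the argument, since \<open>\<omega> = q\<^sup>2\<close>.\<close>
  then have "w 3 4 = exp (2 * \<i> * complex_of_real (Arg (w 3 4) / 2))"
    by (simp add: cis_conv_exp)
  then show "\<exists>h::real. commutation_case w (exp (2 * \<i> * complex_of_real h))"
    using comm by metis
next
  assume "\<exists>h::real. commutation_case w (exp (2 * \<i> * complex_of_real h))"
  then obtain h :: real where h: "commutation_case w (exp (2 * \<i> * complex_of_real h))"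
    by blast
  moreover have "norm (exp (2 * \<i> * complex_of_real h)) = 1"
    by simp
  ultimately show "flow ` quad_ideal w \<subseteq> quad_ideal w \<and> dagger ` quad_ideal w = quad_ideal w"
    using flow_quad_ideal dagger_quad_ideal norm_commutation_case exp_not_eq_zero by metis
qed

section \<open>First integrals and their independence\<close>

definition word_weight :: "4 list \<Rightarrow> int" where
  "word_weight xs = int (count_list xs 1) - int (count_list xs 3)"

definition weight_le :: "int \<Rightarrow> free4 \<Rightarrow> bool" where
  "weight_le k p \<longleftrightarrow> (\<forall>v\<in>Poly_Mapping.keys p. word_weight (letters v) \<le> k)"

lemma word_weight_append: "word_weight (xs @ ys) = word_weight xs + word_weight ys"
  by (simp add: word_weight_def)

lemma weight_le_add: "weight_le k p \<Longrightarrow> weight_le k q \<Longrightarrow> weight_le k (p + q)"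
  using Poly_Mapping.keys_add[of p q] by (auto simp: weight_le_def)

lemma weight_le_mono: "weight_le k p \<Longrightarrow> k \<le> l \<Longrightarrow> weight_le l p"
  by (force simp: weight_le_def)

lemma weight_le_single: "word_weight (letters v) \<le> k \<Longrightarrow> weight_le k (Poly_Mapping.single v c)"
  by (auto simp: weight_le_def)

lemma weight_le_zero: "weight_le k 0"
  by (simp add: weight_le_def)

lemma weight_le_mult:
  assumes "weight_le k p" "weight_le l q"
  shows "weight_le (k + l) (p * q)"
  unfolding weight_le_def
proof
  fix v assume "v \<in> Poly_Mapping.keys (p * q)"
  then obtain a b where "v = a + b" "a \<in> Poly_Mapping.keys p" "b \<in> Poly_Mapping.keys q"
    using Poly_Mapping.keys_mult[of p q] by blast
  then show "word_weight (letters v) \<le> k + l"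
    using assms by (auto simp: weight_le_def plus_fmon_def word_weight_append intro: add_mono)
qed

text \<open>Sorting permutes letters, and the weight only counts them.\<close>

lemma weight_le_normal_form:
  assumes "weight_le k p"
  shows "weight_le k (normal_form w p)"
proof -
  have inv: "word_weight (sort_word xs) = word_weight xs" for xs
    by (simp add: word_weight_def flip: count_mset)
  have "weight_le k (\<Sum>v\<in>A. Poly_Mapping.single (Word (sort_word (letters v)))
       (Poly_Mapping.lookup p v * sort_coeff w (letters v)))"
    if "finite A" "A \<subseteq> Poly_Mapping.keys p" for A
    using that
  proof (induction A)
    case (insert v A)
    then show ?case
      using assms
      by (auto simp: inv weight_le_def[of k p] intro!: weight_le_add weight_le_single)
  qed (simp add: weight_le_zero)
  then show ?thesis
    by (simp add: normal_form_def)
qed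

lemma lookup_eq_0_if_weight_le:
  assumes "weight_le k p" "k < word_weight xs"
  shows "Poly_Mapping.lookup p (Word xs) = 0"
  using assms by (force simp: weight_le_def in_keys_iff)

text \<open>The part of top weight is a single monomial with coefficient 1. Its word may be
  unsorted; the factor from sorting enters only with \<open>normal_form\<close>.\<close>

definition leading_word :: "free4 \<Rightarrow> 4 list \<Rightarrow> bool" where
  "leading_word p xs \<longleftrightarrow> weight_le (word_weight xs - 1) (p - monomial xs)"

text \<open>The difference telescopes into
  \<open>(p - monomial xs) * q + monomial xs * (q - monomial ys)\<close>, and each summand has one
  factor that falls short of the top weight.\<close>

lemma leading_word_mult:
  assumes p: "leading_word p xs" and q: "leading_word q ys"
  shows "leading_word (p * q) (xs @ ys)"
proof -
  let ?k = "word_weight xs" and ?l = "word_weight ys"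
  have xs: "weight_le ?k (monomial xs)" and ys: "weight_le ?l (monomial ys)"
    by (simp_all add: weight_le_single)
  have "weight_le ?l ((q - monomial ys) + monomial ys)"
    by (rule weight_le_add[OF weight_le_mono[OF q[unfolded leading_word_def]] ys]) simp
  then have "weight_le ((?k - 1) + ?l) ((p - monomial xs) * q)"
    using p by (intro weight_le_mult) (simp_all add: leading_word_def)
  moreover have "weight_le (?k + (?l - 1)) (monomial xs * (q - monomial ys))"
    using q by (intro weight_le_mult xs) (simp add: leading_word_def)
  ultimately have "weight_le (?k + ?l - 1) ((p - monomial xs) * q + monomial xs * (q - monomial ys))"
    by (intro weight_le_add) (simp_all add: algebra_simps)
  moreover have "(p - monomial xs) * q + monomial xs * (q - monomial ys) = p * q - monomial (xs @ ys)"
    by (simp add: algebra_simps flip: monomial_mult)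
  ultimately show ?thesis
    by (simp add: leading_word_def word_weight_append)
qed

lemma leading_word_monomial: "leading_word (monomial xs) xs"
  by (simp add: leading_word_def weight_le_zero)

lemma leading_word_power:
  assumes "leading_word p xs"
  shows "leading_word (p ^ n) (concat (replicate n xs))"
proof (induction n)
  case 0
  show ?case
    using leading_word_monomial[of "[]"] by (simp flip: zero_fmon_def)
next
  case (Suc n)
  then show ?case
    using leading_word_mult[OF assms] by simp
qed

lemma sort_coeff_nonzero:
  assumes "\<And>i j. 1 \<le> i \<Longrightarrow> i < j \<Longrightarrow> j \<le> 4 \<Longrightarrow> w i j \<noteq> 0"
  shows "sort_coeff w xs \<noteq> 0"
proof -
  have "swap_coeff w x y \<noteq> 0" for x y
    using assms[of "pos x" "pos y"] pos_range by (simp add: swap_coeff_def)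
  then show ?thesis
    by (induction xs) (auto simp: prod_list_zero_iff)
qed

text \<open>The lower terms cannot reach the weight of \<open>ys\<close>, so only the sorted leading
  word can contribute.\<close>

lemma lookup_normal_form_leading_word:
  assumes "leading_word p xs" "word_weight xs \<le> word_weight ys"
  shows "Poly_Mapping.lookup (normal_form w p) (Word ys) =
    (if sort_word xs = ys then sort_coeff w xs else 0)"
proof -
  have "weight_le (word_weight xs - 1) (normal_form w (p - monomial xs))"
    using assms(1) by (auto simp: leading_word_def intro: weight_le_normal_form)
  then have "Poly_Mapping.lookup (normal_form w (p - monomial xs)) (Word ys) = 0"
    using assms(2) by (intro lookup_eq_0_if_weight_le) auto
  then show ?thesis
    by (simp add: normal_form_diff normal_form_single lookup_minus lookup_single when_def)
qed

lemma normal_form_sum: "normal_form w (sum f A) = (\<Sum>x\<in>A. normal_form w (f x))"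
  by (induction A rule: infinite_finite_induct) (simp_all add: normal_form_zero normal_form_add)

lemma lookup_scalar_mult: "Poly_Mapping.lookup (scalar c * p) v = c * Poly_Mapping.lookup p v"
  by (induction p rule: free4_induct)
    (simp_all add: scalar_mult_single lookup_single lookup_add distrib_left when_def)

section \<open>Independence modulo the ideal\<close>

definition generator_sum :: free4 where
  "generator_sum = gen 1 + gen 2 + gen 3 + gen 0"

definition polynomial_value :: "(nat \<times> nat \<times> nat \<Rightarrow>\<^sub>0 complex) \<Rightarrow> free4" where
  "polynomial_value P = (\<Sum>(a, b, c)\<in>Poly_Mapping.keys P.
     scalar (Poly_Mapping.lookup P (a, b, c)) * (generator_sum ^ 2) ^ a * (gen 1 * gen 3) ^ b * (gen 2 * gen 0) ^ c)"

text \<open>Take a term with the largest exponent of the square. At its sorted leading word any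
  other term could contribute only through its own leading word, and that one has different letter
  counts, so nothing cancels.\<close>

lemma polynomial_value_independent:
  assumes nz: "\<And>i j. 1 \<le> i \<Longrightarrow> i < j \<Longrightarrow> j \<le> 4 \<Longrightarrow> w i j \<noteq> 0"
    and zero: "normal_form w (polynomial_value P) = 0"
  shows "P = 0"
proof (rule ccontr)
  assume "P \<noteq> 0"
  then have "fst ` Poly_Mapping.keys P \<noteq> {}"
    by simp
  then have "Max (fst ` Poly_Mapping.keys P) \<in> fst ` Poly_Mapping.keys P"
    by (intro Max_in) auto
  \<comment> \<open>Any triple with maximal first exponent will do: \<open>b\<close> and
    \<open>c\<close> do not affect the weight.\<close>
  then obtain a b c where abc: "(a, b, c) \<in> Poly_Mapping.keys P" "Max (fst ` Poly_Mapping.keys P) = a"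
    by force
  then have max: "a' \<le> a" if "(a', b', c') \<in> Poly_Mapping.keys P" for a' b' c'
    using that by (metis abc(2) Max_ge finite_imageI finite_keys fst_conv image_eqI)
  define lead :: "nat \<times> nat \<times> nat \<Rightarrow> 4 list" where
    "lead = (\<lambda>(a, b, c). concat (replicate a [1, 1]) @ concat (replicate b [1, 3]) @ concat (replicate c [2, 0]))"
  define power_product where
    "power_product = (\<lambda>(a, b, c). (generator_sum ^ 2) ^ a * ((gen 1 * gen 3) ^ b * (gen 2 * gen 0) ^ c))"
  have "leading_word generator_sum [1]"
    by (auto simp: leading_word_def generator_sum_def gen_monomial word_weight_def
        intro!: weight_le_add weight_le_single)
  then have "leading_word (generator_sum ^ 2) [1, 1]"
    using leading_word_mult[of generator_sum "[1]" generator_sum "[1]"] by (simp add: power2_eq_square)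
  then have leading: "leading_word (power_product k) (lead k)" for k
    by (cases k) (simp add: power_product_def lead_def leading_word_mult leading_word_power
        leading_word_monomial gen_monomial monomial_mult)
  have count: "count_list (concat (replicate n xs)) x = n * count_list xs x" for n xs and x :: 4
    by (induction n) simp_all
  have counts: "count_list (lead (a, b, c)) 1 = 2 * a + b" "count_list (lead (a, b, c)) 3 = b"
    "count_list (lead (a, b, c)) 2 = c" for a b c
    by (simp_all add: lead_def count)
  have weight: "word_weight (lead (a, b, c)) = 2 * int a" for a b c
    by (simp add: word_weight_def counts)
  \<comment> \<open>The number of letters u_3 gives \<open>b\<close>, that of u_2 gives
    \<open>c\<close>, and then that of u_1 gives \<open>a\<close>.\<close>
  have inj: "k = (a, b, c)" if "sort_word (lead k) = sort_word (lead (a, b, c))" for k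
  proof -
    obtain a' b' c' where k: "k = (a', b', c')"
      by (cases k)
    have "count_list (lead k) x = count_list (lead (a, b, c)) x" for x
      using that by (metis count_mset mset_sort_word)
    from this[of 1] this[of 2] this[of 3] show ?thesis
      by (simp add: k counts)
  qed
  let ?v = "Word (sort_word (lead (a, b, c)))"
  have "Poly_Mapping.lookup (normal_form w (power_product k)) ?v =
      (if k = (a, b, c) then sort_coeff w (lead k) else 0)" if k: "k \<in> Poly_Mapping.keys P" for k
  proof -
    \<comment> \<open>The weights are twice the first exponents, so this is the maximality of
      \<open>a\<close>.\<close>
    have "word_weight (lead k) \<le> word_weight (sort_word (lead (a, b, c)))"
      using max k weight by (cases k) (auto simp: word_weight_def simp flip: count_mset)
    then show ?thesis
      using lookup_normal_form_leading_word[OF leading] inj by auto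
  qed
  moreover have "polynomial_value P =
      (\<Sum>k\<in>Poly_Mapping.keys P. scalar (Poly_Mapping.lookup P k) * power_product k)"
    by (auto simp: polynomial_value_def power_product_def mult.assoc intro!: sum.cong)
  ultimately have "Poly_Mapping.lookup (normal_form w (polynomial_value P)) ?v =
      (\<Sum>k\<in>Poly_Mapping.keys P. 
        Poly_Mapping.lookup P k * (if k = (a, b, c) then sort_coeff w (lead k) else 0))"
    by (simp add: normal_form_sum normal_form_scalar_mult lookup_sum lookup_scalar_mult)
  also have "\<dots> = Poly_Mapping.lookup P (a, b, c) * sort_coeff w (lead (a, b, c))"
    using abc(1) by (simp add: if_distrib[of "(*) _"] cong: if_cong)
  finally have "Poly_Mapping.lookup P (a, b, c) * sort_coeff w (lead (a, b, c)) = 0"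
    using zero by simp
  then show False
    using abc(1) sort_coeff_nonzero[of w, OF nz] by (auto simp: in_keys_iff)
qed

section \<open>Passage to the quotient ring\<close>

lemma free_ring_simps:
  "carrier free_ring = UNIV" "p \<otimes>\<^bsub>free_ring\<^esub> q = p * q" "p \<oplus>\<^bsub>free_ring\<^esub> q = p + q"
  "\<one>\<^bsub>free_ring\<^esub> = 1" "\<zero>\<^bsub>free_ring\<^esub> = 0"
  by (simp_all add: free_ring_def)

lemma coset_ring_hom:
  "coset (quad_ideal w) \<in> ring_hom free_ring (quotient_ring (quad_ideal w))"
  using ideal.rcos_ring_hom[OF ideal_quad_ideal] by (simp add: coset_def[abs_def])

lemma coset_carrier: "coset (quad_ideal w) p \<in> carrier (quotient_ring (quad_ideal w))"
  using ring_hom_closed[OF coset_ring_hom, of p] by (simp add: free_ring_simps)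

lemma coset_mult:
  "coset (quad_ideal w) p \<otimes>\<^bsub>quotient_ring (quad_ideal w)\<^esub> coset (quad_ideal w) q = coset (quad_ideal w) (p * q)"
  using ring_hom_mult[OF coset_ring_hom, of p q] by (simp add: free_ring_simps)

lemma coset_add:
  "coset (quad_ideal w) p \<oplus>\<^bsub>quotient_ring (quad_ideal w)\<^esub> coset (quad_ideal w) q = coset (quad_ideal w) (p + q)"
  using ring_hom_add[OF coset_ring_hom, of p q] by (simp add: free_ring_simps)

lemma coset_zero: "coset (quad_ideal w) 0 = \<zero>\<^bsub>quotient_ring (quad_ideal w)\<^esub>"
  using ring_hom_zero[OF coset_ring_hom ring_free_ring ideal.quotient_is_ring[OF ideal_quad_ideal]]
  by (simp add: free_ring_simps)

lemma coset_one: "coset (quad_ideal w) 1 = \<one>\<^bsub>quotient_ring (quad_ideal w)\<^esub>"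
  using ring_hom_one[OF coset_ring_hom] by (simp add: free_ring_simps)

lemma coset_power:
  "coset (quad_ideal w) p [^]\<^bsub>quotient_ring (quad_ideal w)\<^esub> (n::nat) = coset (quad_ideal w) (p ^ n)"
  by (induction n) (simp_all add: coset_one coset_mult power_commutes)

lemma coset_eq_iff: "coset (quad_ideal w) p = coset (quad_ideal w) q \<longleftrightarrow> p - q \<in> quad_ideal w"
proof -
  have c: "coset (quad_ideal w) r = {i + r | i. i \<in> quad_ideal w}" for r
    by (auto simp: coset_def a_r_coset_def' free_ring_def)
  have neg: "- r \<in> quad_ideal w" if "r \<in> quad_ideal w" for r
    using quad_ideal_mult_left[OF that, of "- 1"] by simp
  show ?thesis
  proof
    assume "coset (quad_ideal w) p = coset (quad_ideal w) q"
    moreover have "p \<in> coset (quad_ideal w) p"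
      using quad_ideal_zero by (auto simp: c)
    ultimately show "p - q \<in> quad_ideal w"
      by (auto simp: c)
  next
    assume pq: "p - q \<in> quad_ideal w"
    have sub: "coset (quad_ideal w) p \<subseteq> coset (quad_ideal w) q" if "p - q \<in> quad_ideal w" for p q
    proof
      fix x assume "x \<in> coset (quad_ideal w) p"
      then obtain i where "i \<in> quad_ideal w" "x = i + p"
        by (auto simp: c)
      then have "i + (p - q) \<in> quad_ideal w" "x = (i + (p - q)) + q"
        using that by (simp_all add: quad_ideal_add)
      then show "x \<in> coset (quad_ideal w) q"
        unfolding c by blast
    qed
    show "coset (quad_ideal w) p = coset (quad_ideal w) q"
      using sub[OF pq] sub[of q p] neg[OF pq] by auto
  qed
qed

lemma finsum_coset:
  assumes "finite A"
  shows "finsum (quotient_ring (quad_ideal w)) (\<lambda>x. coset (quad_ideal w) (f x)) A =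
    coset (quad_ideal w) (sum f A)"
proof -
  interpret ring "quotient_ring (quad_ideal w)"
    by (rule ideal.quotient_is_ring[OF ideal_quad_ideal])
  show ?thesis
    using assms by induction (simp_all add: coset_zero coset_carrier coset_add Pi_def)
qed

text \<open>Lifts the evaluation to the free algebra, where
  \<open>polynomial_value_independent\<close> applies.\<close>

lemma eval3_coset:
  "eval3 (quad_ideal w) (coset (quad_ideal w) (generator_sum ^ 2)) (coset (quad_ideal w) (gen 1 * gen 3))
     (coset (quad_ideal w) (gen 2 * gen 0)) P = coset (quad_ideal w) (polynomial_value P)"
  by (simp add: eval3_def polynomial_value_def coset_power coset_mult case_prod_unfold finsum_coset)

lemma commuting_coset:
  "commuting (quad_ideal w) (coset (quad_ideal w) p) (coset (quad_ideal w) q) \<longleftrightarrow>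
     normal_form w (p * q - q * p) = 0"
  by (simp add: commuting_def coset_mult coset_eq_iff quad_ideal_iff)

lemma first_integral_coset:
  assumes "volterra2 h ` quad_ideal w \<subseteq> quad_ideal w" "flow p \<in> quad_ideal w"
  shows "first_integral (quad_ideal w) (volterra2 h) (coset (quad_ideal w) p)"
proof -
  have "induced (quad_ideal w) (volterra2 h) (coset (quad_ideal w) p) = coset (quad_ideal w) (volterra2 h p)"
    by (rule induced_coset[OF ideal_quad_ideal assms(1)]) (simp add: volterra2_def derivation_add)
  moreover have "coset (quad_ideal w) (volterra2 h p) = coset (quad_ideal w) 0"
    using assms(2) by (simp add: coset_eq_iff volterra2_in_quad_ideal_iff)
  ultimately show ?thesis
    by (simp add: first_integral_def coset_carrier coset_zero)
qed

section \<open>The three integrals in the four cases\<close>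

lemma square_commutes_quad_ideal:
  assumes "x * p - scalar s * (p * x) \<in> quad_ideal w" "s * s = 1"
  shows "x ^ 2 * p - p * x ^ 2 \<in> quad_ideal w"
proof -
  \<comment> \<open>Moving \<open>p\<close> past \<open>x\<close> twice costs
    \<open>s * s = 1\<close>; the commutator is thus a sum of two multiples of the assumed
    element.\<close>
  have "scalar s * (scalar s * y) = y" for y
    using assms(2) by (metis mult.assoc mult_1 scalar_simps(2,4))
  then have "x ^ 2 * p - p * x ^ 2 =
      x * (x * p - scalar s * (p * x)) + scalar s * (x * p - scalar s * (p * x)) * x"
    by (simp add: power2_eq_square algebra_simps mult_scalar_left[of x])
  then show ?thesis
    by (simp only: assms(1) quad_ideal_add quad_ideal_mult_left quad_ideal_mult_right)
qed

lemma normal_form_first_integrals: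
  assumes "commutation_case w \<omega>" "\<omega> \<noteq> 0"
  shows "normal_form w (flow generator_sum) = 0" "normal_form w (flow (gen 1 * gen 3)) = 0"
    "normal_form w (flow (gen 2 * gen 0)) = 0"
    "normal_form w (generator_sum ^ 2 * (gen 1 * gen 3) - (gen 1 * gen 3) * generator_sum ^ 2) = 0"
    "normal_form w (generator_sum ^ 2 * (gen 2 * gen 0) - (gen 2 * gen 0) * generator_sum ^ 2) = 0"
    "normal_form w (gen 1 * gen 3 * (gen 2 * gen 0) - gen 2 * gen 0 * (gen 1 * gen 3)) = 0"
proof -
  obtain s t v where unit: "s * s = 1" "t * t = 1" "\<omega> * v = 1"
    and "w 1 2 = s * t * \<omega>" "w 1 3 = s" "w 2 3 = t * \<omega>" "w 1 4 = s * v" "w 2 4 = t" "w 3 4 = \<omega>"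
    using commutation_caseE[OF assms] .
  \<comment> \<open>The simplifier writes the natural number 1 as \<open>Suc 0\<close>, and the
    equations have to match that form.\<close>
  note w = this(4-)[unfolded One_nat_def]
  note units = mult_ac unit mult_cancel_unit[OF unit(1)]
        mult_cancel_unit[OF unit(2)] mult_cancel_unit[OF unit(3)]
  \<comment> \<open>The 24 terms of this sum cancel in pairs, already in the free algebra.\<close>
  have "flow generator_sum = flow_rate 1 + flow_rate 2 + flow_rate 3 + flow_rate 0"
    by (simp add: generator_sum_def flow_def derivation_add derivation_gen)
  then show "normal_form w (flow generator_sum) = 0"
    by (simp add: flow_rate_monomials normal_form_eval w units)
  have "flow (gen m * gen n) = flow_rate m * gen n + gen m * flow_rate n" for m n
    by (simp add: flow_def derivation_mult derivation_gen)
  then show "normal_form w (flow (gen 1 * gen 3)) = 0" "normal_form w (flow (gen 2 * gen 0)) = 0"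
    by (simp_all add: flow_rate_monomials normal_form_eval normal_form_uminus
        distrib_left distrib_right left_diff_distrib right_diff_distrib w units)
  \<comment> \<open>Each of the four generators passes u_1 u_3 with the same factor
    \<open>s\<close>, and u_2 u_4 with the same factor \<open>t\<close>, so their sum does
    too.\<close>
  have "normal_form w (generator_sum * (gen 1 * gen 3) - scalar s * (gen 1 * gen 3 * generator_sum)) = 0"
    "normal_form w (generator_sum * (gen 2 * gen 0) - scalar t * (gen 2 * gen 0 * generator_sum)) = 0"
    by (simp_all add: generator_sum_def normal_form_eval
        distrib_left distrib_right left_diff_distrib right_diff_distrib w units)
  then show "normal_form w (generator_sum ^ 2 * (gen 1 * gen 3) - (gen 1 * gen 3) * generator_sum ^ 2) = 0"
    "normal_form w (generator_sum ^ 2 * (gen 2 * gen 0) - (gen 2 * gen 0) * generator_sum ^ 2) = 0"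
    using unit(1,2) by (auto simp flip: quad_ideal_iff intro: square_commutes_quad_ideal)
  \<comment> \<open>Both u_1 and u_3 pick up \<open>t\<close> on passing u_2 u_4, in total
    \<open>t * t = 1\<close>.\<close>
  show "normal_form w (gen 1 * gen 3 * (gen 2 * gen 0) - gen 2 * gen 0 * (gen 1 * gen 3)) = 0"
    by (simp add: normal_form_eval w units)
qed

lemma super_integrable_commutation_case:
  assumes nz: "\<And>i j. 1 \<le> i \<Longrightarrow> i < j \<Longrightarrow> j \<le> 4 \<Longrightarrow> w i j \<noteq> 0"
    and w: "commutation_case w \<omega>" "\<omega> \<noteq> 0"
  shows "super_integrable (quad_ideal w) (volterra2 h)"
proof -
  note integrals = normal_form_first_integrals[OF w, folded quad_ideal_iff]
  have stable: "volterra2 h ` quad_ideal w \<subseteq> quad_ideal w"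
    using flow_quad_ideal[OF w] by (auto simp: volterra2_in_quad_ideal_iff)
  \<comment> \<open>Leibniz rule: both terms have the flow of the sum as a factor.\<close>
  have "flow (generator_sum ^ 2) \<in> quad_ideal w"
    using integrals(1)
    by (simp add: power2_eq_square flow_def derivation_mult quad_ideal_add quad_ideal_mult_left
        quad_ideal_mult_right)
  moreover have "alg_independent3 (quad_ideal w) (coset (quad_ideal w) (generator_sum ^ 2))
      (coset (quad_ideal w) (gen 1 * gen 3)) (coset (quad_ideal w) (gen 2 * gen 0))"
    using polynomial_value_independent[of w, OF nz]
    by (simp add: alg_independent3_def eval3_coset coset_eq_iff quad_ideal_iff flip: coset_zero)
  ultimately show ?thesis
    unfolding super_integrable_def
    using stable integrals(2-3) normal_form_first_integrals(4-6)[OF w]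
    by (intro conjI exI[of _ "coset (quad_ideal w) (generator_sum ^ 2)"]
        exI[of _ "coset (quad_ideal w) (gen 1 * gen 3)"] exI[of _ "coset (quad_ideal w) (gen 2 * gen 0)"])
      (simp_all add: first_integral_coset commuting_coset)
qed

theorem theorem6:
  fixes w :: "nat \<Rightarrow> nat \<Rightarrow> complex" and h0 :: real
  assumes "\<And>i j. 1 \<le> i \<Longrightarrow> i < j \<Longrightarrow> j \<le> 4 \<Longrightarrow> w i j \<noteq> 0"
  shows "(volterra2 h0 ` quad_ideal w \<subseteq> quad_ideal w \<and> dagger ` quad_ideal w = quad_ideal w
            \<longleftrightarrow> (\<exists>h::real. commutation_case w (exp (2 * \<i> * complex_of_real h))))
       \<and> (\<forall>h::real. commutation_case w (exp (2 * \<i> * complex_of_real h))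
            \<longrightarrow> super_integrable (quad_ideal w) (volterra2 h))"
proof -
  \<comment> \<open>The two derivations differ by the nonzero scalar
    \<open>q\<^sup>2\<close>.\<close>
  have "volterra2 h0 ` quad_ideal w \<subseteq> quad_ideal w \<longleftrightarrow> flow ` quad_ideal w \<subseteq> quad_ideal w"
    by (simp add: image_subset_iff volterra2_in_quad_ideal_iff)
  then show ?thesis
    using stable_iff_commutation_case[of w, OF assms]
      super_integrable_commutation_case[of w, OF assms _ exp_not_eq_zero]
    by simp
qed

end
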